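(* The logic $\mathrm{TeamLTL}^l$ (LTL formulae in negation normal form evaluated under the lax team semantics $\models^l$) satisfies downward closure, the empty team property, singleton equivalence and flatness; that is, for every such formula $\varphi$, every team $T$ and every trace $t$: (1) if $T\models^l\varphi$ and $S\subseteq T$ then $S\models^l\varphi$; (2) $\emptyset\models^l\varphi$; (3) $\{t\}\models^l\varphi$ iff $t\models\varphi$; (4) $T\models^l\varphi$ iff $\{s\}\models^l\varphi$ for all $s\in T$.
   Context: A trace over a set $\mathrm{AP}$ of atomic propositions is an infinite sequence $t\in(2^{\mathrm{AP}})^\omega$; $t[i,\infty]$ is its suffix from position $i$. A team is a set of traces. LTL formulae (in negation normal form) are built by $\varphi::=p\mid\neg p\mid\varphi\lor\varphi\mid\varphi\land\varphi\mid \mathsf{X}\varphi\mid\mathsf{G}\varphi\mid\varphi\,\mathsf{U}\,\varphi$ ($p\in\mathrm{AP}$), with the usual semantics $t\models\varphi$ on single traces. Lax team semantics: write $\mathcal P(\mathbb N)^+$ for the nonempty subsets of $\mathbb N$; for $f:T\to\mathcal P(\mathbb N)^+$ put $T[f,\infty]=\{t[s,\infty]\mid t\in T, s\in f(t)\}$, and $T[1,\infty]=\{t[1,\infty]\mid t\in T\}$. For $T'\subseteq T$, $f:T\to\mathcal P(\mathbb N)^+$, $f':T'\to\mathcal P(\mathbb N)^+$, write $f'<f$ iff for all $t\in T'$: $\min f'(t)\le\min f(t)$ and $\max f'(t)<\max f(t)$ (the latter required only when $\max f(t)$ exists). Then: $T\models^l l$ (literal $l$) iff $t\models l$ for all $t\in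 T$; $T\models^l\varphi\land\psi$ iff both hold; $T\models^l\varphi\lor\psi$ iff there are $T_1\cup T_2=T$ with $T_1\models^l\varphi$, $T_2\models^l\psi$; $T\models^l\mathsf X\varphi$ iff $T[1,\infty]\models^l\varphi$; $T\models^l\mathsf G\varphi$ iff $T[f,\infty]\models^l\varphi$ for all $f:T\to\mathcal P(\mathbb N)^+$; $T\models^l\varphi\,\mathsf U\,\psi$ iff there is $f:T\to\mathcal P(\mathbb N)^+$ with $T[f,\infty]\models^l\psi$ and, for $T'=\{t\in T\mid f(t)\neq\{0\}\}$, for every $f':T'\to\mathcal P(\mathbb N)^+$ with $f'<f$ we have $T'[f',\infty]\models^l\varphi$ or $T'=\emptyset$. *)

theory Defs
  imports Main "HOL-Library.FuncSet" "HOL-Library.Omega_Words_Fun"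
begin

type_synonym 'ap trace = "'ap set word"

type_synonym 'ap team = "'ap trace set"

datatype 'ap ltl =
    Prop 'ap
  | NProp 'ap
  | Or "'ap ltl" "'ap ltl"
  | And "'ap ltl" "'ap ltl"
  | Next "'ap ltl"
  | Globally "'ap ltl"
  | Until "'ap ltl" "'ap ltl"

primrec ltl_sat :: "'ap trace \<Rightarrow> 'ap ltl \<Rightarrow> bool" (infix \<open>\<Turnstile>\<close> 50) where
  "t \<Turnstile> Prop p \<longleftrightarrow> p \<in> t 0"
| "t \<Turnstile> NProp p \<longleftrightarrow> p \<notin> t 0"
| "t \<Turnstile> Or \<phi> \<psi> \<longleftrightarrow> t \<Turnstile> \<phi> \<or> t \<Turnstile> \<psi>"
| "t \<Turnstile> And \<phi> \<psi> \<longleftrightarrow> t \<Turnstile> \<phi> \<and> t \<Turnstile> \<psi>"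
| "t \<Turnstile> Next \<phi> \<longleftrightarrow> suffix 1 t \<Turnstile> \<phi>"
| "t \<Turnstile> Globally \<phi> \<longleftrightarrow> (\<forall>i. suffix i t \<Turnstile> \<phi>)"
| "t \<Turnstile> Until \<phi> \<psi> \<longleftrightarrow> (\<exists>i. suffix i t \<Turnstile> \<psi> \<and> (\<forall>j<i. suffix j t \<Turnstile> \<phi>))"

definition nonempty_times :: "nat set set" where
  "nonempty_times = {A. A \<noteq> {}}"

definition team_suffix :: "'ap team \<Rightarrow> ('ap trace \<Rightarrow> nat set) \<Rightarrow> 'ap team" where
  "team_suffix T f = {suffix s t | s t. t \<in> T \<and> s \<in> f t}"

definition team_next :: "'ap team \<Rightarrow> 'ap team" where
  "team_next T = {suffix 1 t | t. t \<in> T}"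

text \<open>
  The relation $f' < f$ on the domain $T'$ of $f'$. On nonempty sets of naturals, \<^const>\<open>Inf\<close> is
  the minimum, also for infinite sets, and the maximum exists iff the set is finite. If $f(t)$
  has a maximum, then $\max f'(t) < \max f(t)$ includes that $f'(t)$ has one, too.
\<close>

definition earlier :: "'ap team \<Rightarrow> ('ap trace \<Rightarrow> nat set) \<Rightarrow> ('ap trace \<Rightarrow> nat set) \<Rightarrow> bool" where
  "earlier T' f' f \<longleftrightarrow>
     (\<forall>t\<in>T'. Inf (f' t) \<le> Inf (f t) \<and>
       (finite (f t) \<longrightarrow> finite (f' t) \<and> Max (f' t) < Max (f t)))"

text \<open>
  Maps $T \to \mathcal{P}(\mathbb{N})^+$ are total functions constrained on $T$ only; their values
  outside $T$ are irrelevant.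
\<close>

primrec team_sat :: "'ap team \<Rightarrow> 'ap ltl \<Rightarrow> bool" (infix \<open>\<Turnstile>\<^sup>l\<close> 50) where
  "T \<Turnstile>\<^sup>l Prop p \<longleftrightarrow> (\<forall>t\<in>T. t \<Turnstile> Prop p)"
| "T \<Turnstile>\<^sup>l NProp p \<longleftrightarrow> (\<forall>t\<in>T. t \<Turnstile> NProp p)"
| "T \<Turnstile>\<^sup>l Or \<phi> \<psi> \<longleftrightarrow> (\<exists>T1 T2. T1 \<union> T2 = T \<and> T1 \<Turnstile>\<^sup>l \<phi> \<and> T2 \<Turnstile>\<^sup>l \<psi>)"
| "T \<Turnstile>\<^sup>l And \<phi> \<psi> \<longleftrightarrow> T \<Turnstile>\<^sup>l \<phi> \<and> T \<Turnstile>\<^sup>l \<psi>"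
| "T \<Turnstile>\<^sup>l Next \<phi> \<longleftrightarrow> team_next T \<Turnstile>\<^sup>l \<phi>"
| "T \<Turnstile>\<^sup>l Globally \<phi> \<longleftrightarrow> (\<forall>f \<in> T \<rightarrow> nonempty_times. team_suffix T f \<Turnstile>\<^sup>l \<phi>)"
| "T \<Turnstile>\<^sup>l Until \<phi> \<psi> \<longleftrightarrow>
     (\<exists>f \<in> T \<rightarrow> nonempty_times.
        team_suffix T f \<Turnstile>\<^sup>l \<psi> \<and>
        (let T' = {t \<in> T. f t \<noteq> {0}} in
           \<forall>f' \<in> T' \<rightarrow> nonempty_times.
             earlier T' f' f \<longrightarrow> team_suffix T' f' \<Turnstile>\<^sup>l \<phi> \<or> T' = {}))"

end

theory Submission
  imports Defs
begin

text \<open>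
  All four properties follow from one equivalence, proved by induction on the formula: a team
  satisfies a formula iff each of its traces does. For \<^const>\<open>Until\<close>, the minimum of $f(t)$ is a
  witness for the trace $t$: every time $j$ before it is reached by an earlier $f'$ with
  $f'(t) = \{j\}$ and $f'(s) = \{0\}$ for $s \neq t$. Conversely,
  any choice of witnesses for the traces gives a singleton-valued $f$.
\<close>

definition delayed :: "'ap team \<Rightarrow> ('ap trace \<Rightarrow> nat set) \<Rightarrow> 'ap team" where
  "delayed T f = {t \<in> T. f t \<noteq> {0}}"

definition until_times ::
    "('ap trace \<Rightarrow> nat \<Rightarrow> bool) \<Rightarrow> ('ap trace \<Rightarrow> nat \<Rightarrow> bool) \<Rightarrow> 'ap team \<Rightarrow>
      ('ap trace \<Rightarrow> nat set) \<Rightarrow> bool" where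
  "until_times P Q T f \<longleftrightarrow> (\<forall>t\<in>T. \<forall>s\<in>f t. Q t s) \<and>
     (\<forall>f' \<in> delayed T f \<rightarrow> nonempty_times. earlier (delayed T f) f' f \<longrightarrow>
        (\<forall>t\<in>delayed T f. \<forall>s\<in>f' t. P t s))"

lemma ball_team_suffix_iff: "(\<forall>u\<in>team_suffix T f. P u) \<longleftrightarrow> (\<forall>t\<in>T. \<forall>s\<in>f t. P (suffix s t))"
  by (auto simp: team_suffix_def)

lemma ball_team_next_iff: "(\<forall>u\<in>team_next T. P u) \<longleftrightarrow> (\<forall>t\<in>T. P (suffix 1 t))"
  by (auto simp: team_next_def)

lemma ex_cover_iff_ball_disj:
  "(\<exists>A B. A \<union> B = T \<and> (\<forall>t\<in>A. P t) \<and> (\<forall>t\<in>B. Q t)) \<longleftrightarrow> (\<forall>t\<in>T. P t \<or> Q t)"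
proof
  assume "\<forall>t\<in>T. P t \<or> Q t"
  then have "{t \<in> T. P t} \<union> {t \<in> T. Q t} = T"
    by blast
  then show "\<exists>A B. A \<union> B = T \<and> (\<forall>t\<in>A. P t) \<and> (\<forall>t\<in>B. Q t)"
    by blast
qed blast

lemma ball_times_iff_all:
  "(\<forall>f \<in> T \<rightarrow> nonempty_times. \<forall>t\<in>T. \<forall>s\<in>f t. P t s) \<longleftrightarrow> (\<forall>t\<in>T. \<forall>s. P t s)"
proof
  assume all: "\<forall>f \<in> T \<rightarrow> nonempty_times. \<forall>t\<in>T. \<forall>s\<in>f t. P t s"
  have "(\<lambda>_. {s}) \<in> T \<rightarrow> nonempty_times" for s
    by (simp add: nonempty_times_def)
  with all have "\<forall>t\<in>T. \<forall>s'\<in>{s}. P t s'" for s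
    by (rule bspec)
  then show "\<forall>t\<in>T. \<forall>s. P t s"
    by simp
qed blast

lemma earlier_singleton_less:
  assumes "earlier T' f' f" "t \<in> T'" "f t = {i}" "s \<in> f' t"
  shows "s < i"
proof -
  have "finite (f' t)" "Max (f' t) < i"
    using assms(1-3) by (auto simp: earlier_def)
  then show ?thesis
    using assms(4) Max_ge by (meson le_less_trans)
qed

lemma earlier_fun_upd:
  assumes nonempty: "\<And>s. s \<in> T \<Longrightarrow> f s \<noteq> {}" and "t \<in> T" "j < Inf (f t)"
  shows "earlier (delayed T f) ((\<lambda>_. {0})(t := {j})) f"
proof -
  have "j < Max (f t)" if "finite (f t)"
  proof -
    have "Inf (f t) \<le> Max (f t)"
      using that nonempty[OF \<open>t \<in> T\<close>] by (simp add: Inf_nat_def1)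
    with \<open>j < Inf (f t)\<close> show ?thesis
      by (rule less_le_trans)
  qed
  moreover have "0 < Max (f s)" if "s \<in> delayed T f" "finite (f s)" for s
  proof -
    have "f s \<noteq> {}" "f s \<noteq> {0}"
      using that(1) nonempty by (auto simp: delayed_def)
    then have "\<not> f s \<subseteq> {0}"
      by (simp add: subset_singleton_iff)
    then obtain a where "a \<in> f s" "0 < a"
      by auto
    then show ?thesis
      using that(2) Max_ge by (meson less_le_trans)
  qed
  ultimately show ?thesis
    using \<open>j < Inf (f t)\<close> by (simp add: earlier_def)
qed

lemma until_times_imp_ex_witness:
  assumes f: "f \<in> T \<rightarrow> nonempty_times" and until: "until_times P Q T f" and t: "t \<in> T"
  shows "\<exists>i. Q t i \<and> (\<forall>j<i. P t j)"
proof -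
  have nonempty: "f s \<noteq> {}" if "s \<in> T" for s
    using f that by (auto simp: nonempty_times_def)
  have "P t j" if j: "j < Inf (f t)" for j
  proof -
    let ?f' = "(\<lambda>_. {0})(t := {j})"
    have "?f' \<in> delayed T f \<rightarrow> nonempty_times"
      by (simp add: nonempty_times_def)
    moreover have "earlier (delayed T f) ?f' f"
      using nonempty t j by (rule earlier_fun_upd)
    moreover have "t \<in> delayed T f"
    proof -
      have "f t \<noteq> {0}"
        using j by (metis cInf_singleton not_less0)
      with t show ?thesis
        by (simp add: delayed_def)
    qed
    moreover have "j \<in> ?f' t"
      by simp
    ultimately show ?thesis
      using until unfolding until_times_def by fast
  qed
  moreover have "Q t (Inf (f t))"
    using until t nonempty by (simp add: until_times_def Inf_nat_def1)
  ultimately show ?thesis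
    by blast
qed

lemma until_times_singleton:
  assumes Q: "\<And>t. t \<in> T \<Longrightarrow> Q t (i t)" and P: "\<And>t j. t \<in> T \<Longrightarrow> j < i t \<Longrightarrow> P t j"
  shows "until_times P Q T (\<lambda>t. {i t})"
proof -
  have "P t s"
    if "earlier (delayed T (\<lambda>t. {i t})) f' (\<lambda>t. {i t})"
      "t \<in> delayed T (\<lambda>t. {i t})" "s \<in> f' t" for f' t s
  proof (rule P)
    show "t \<in> T"
      using that(2) by (simp add: delayed_def)
    show "s < i t"
      using that by (blast intro: earlier_singleton_less)
  qed
  with Q show ?thesis
    by (simp add: until_times_def)
qed

lemma ex_until_times_iff:
  "(\<exists>f \<in> T \<rightarrow> nonempty_times. until_times P Q T f) \<longleftrightarrow> (\<forall>t\<in>T. \<exists>i. Q t i \<and> (\<forall>j<i. P t j))"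
proof
  assume "\<exists>f \<in> T \<rightarrow> nonempty_times. until_times P Q T f"
  then show "\<forall>t\<in>T. \<exists>i. Q t i \<and> (\<forall>j<i. P t j)"
    using until_times_imp_ex_witness by (elim bexE, intro ballI)
next
  assume "\<forall>t\<in>T. \<exists>i. Q t i \<and> (\<forall>j<i. P t j)"
  then obtain i where "\<And>t. t \<in> T \<Longrightarrow> Q t (i t)" "\<And>t j. t \<in> T \<Longrightarrow> j < i t \<Longrightarrow> P t j"
    by metis
  then have "until_times P Q T (\<lambda>t. {i t})"
    by (rule until_times_singleton)
  moreover have "(\<lambda>t. {i t}) \<in> T \<rightarrow> nonempty_times"
    by (simp add: nonempty_times_def)
  ultimately show "\<exists>f \<in> T \<rightarrow> nonempty_times. until_times P Q T f"
    by (rule bexI)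
qed

lemma team_sat_iff_ball: "T \<Turnstile>\<^sup>l \<phi> \<longleftrightarrow> (\<forall>t\<in>T. t \<Turnstile> \<phi>)"
proof (induction \<phi> arbitrary: T)
  case (Or \<phi> \<psi>)
  then show ?case
    by (simp add: ex_cover_iff_ball_disj)
next
  case (Next \<phi>)
  then show ?case
    by (simp add: ball_team_next_iff)
next
  case (Globally \<phi>)
  then show ?case
    by (simp add: ball_team_suffix_iff ball_times_iff_all)
next
  case (Until \<phi> \<psi>)
  have "team_suffix T' f \<Turnstile>\<^sup>l \<phi> \<or> T' = {} \<longleftrightarrow> (\<forall>t\<in>T'. \<forall>s\<in>f t. suffix s t \<Turnstile> \<phi>)" for T' f
    by (auto simp: Until ball_team_suffix_iff)
  then have "T \<Turnstile>\<^sup>l Until \<phi> \<psi> \<longleftrightarrow>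
      (\<exists>f \<in> T \<rightarrow> nonempty_times. until_times (\<lambda>t s. suffix s t \<Turnstile> \<phi>) (\<lambda>t s. suffix s t \<Turnstile> \<psi>) T f)"
    by (simp only: team_sat.simps Let_def delayed_def until_times_def Until ball_team_suffix_iff)
  then show ?case
    by (simp add: ex_until_times_iff)
qed auto

lemma team_sat_antimono: "T \<Turnstile>\<^sup>l \<phi> \<Longrightarrow> S \<subseteq> T \<Longrightarrow> S \<Turnstile>\<^sup>l \<phi>"
  by (auto simp: team_sat_iff_ball)

lemma team_sat_empty: "{} \<Turnstile>\<^sup>l \<phi>"
  by (simp add: team_sat_iff_ball)

lemma team_sat_singleton_iff: "{t} \<Turnstile>\<^sup>l \<phi> \<longleftrightarrow> t \<Turnstile> \<phi>"
  by (simp add: team_sat_iff_ball)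

lemma team_sat_flat: "T \<Turnstile>\<^sup>l \<phi> \<longleftrightarrow> (\<forall>s\<in>T. {s} \<Turnstile>\<^sup>l \<phi>)"
  by (simp add: team_sat_iff_ball)

theorem theorem5:
  shows "(\<forall>(\<phi> :: 'ap ltl) T S. T \<Turnstile>\<^sup>l \<phi> \<and> S \<subseteq> T \<longrightarrow> S \<Turnstile>\<^sup>l \<phi>) \<and>
         (\<forall>\<phi> :: 'ap ltl. {} \<Turnstile>\<^sup>l \<phi>) \<and>
         (\<forall>(\<phi> :: 'ap ltl) t. {t} \<Turnstile>\<^sup>l \<phi> \<longleftrightarrow> t \<Turnstile> \<phi>) \<and>
         (\<forall>(\<phi> :: 'ap ltl) T. T \<Turnstile>\<^sup>l \<phi> \<longleftrightarrow> (\<forall>s\<in>T. {s} \<Turnstile>\<^sup>l \<phi>))"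
proof (intro conjI allI impI)
  show "S \<Turnstile>\<^sup>l \<phi>" if "T \<Turnstile>\<^sup>l \<phi> \<and> S \<subseteq> T" for \<phi> :: "'ap ltl" and T S
    using that team_sat_antimono by blast
qed (rule team_sat_empty team_sat_singleton_iff team_sat_flat)+

end
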